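(* (Mean Hitting Time Formula for OQWs) Let $\Phi$ be a finite ergodic open quantum random walk with degree of freedom $n\ge 2$ and $k\ge 2$ sites, let $\hat{\mathcal Z}$ be its fundamental matrix and $\hat K=(\hat k_{ij})$ its mean hitting time operator. Let $\hat D$ be the block-diagonal operator with diagonal entries $\hat k_{11},\dots,\hat k_{kk}$ and let $\hat N:=\hat K-\hat D$. Then for every density matrix $\rho\in M_n(\mathbb C)$ and all $i,j=1,\dots,k$, $$\mathrm{Tr}(\hat N_{ij}\rho)=\mathrm{Tr}\big([(\hat D\hat{\mathcal Z})_{ii}-(\hat D\hat{\mathcal Z})_{ij}]\rho\big).$$
   Context: OQW. Let $k$ (number of sites) and $n$ (degree of freedom) be positive integers. A finite open quantum random walk (OQW) $\Phi$ is given by matrices $B_{ij}\in M_n(\mathbb C)$, $i,j=1,\dots,k$, with $\sum_{i=1}^k B_{ij}^*B_{ij}=I$ for each $j$; $B_{ij}$ is the effect of passing from site $j$ to site $i$. For $C\in M_n(\mathbb C)$ let $M_C:M_n(\mathbb C)\to M_n(\mathbb C)$, $M_C(X)=CXC^*$. Block operators. A block operator is a $k\times k$ array $\hat A=(\hat A_{ij})$ of linear maps $\hat A_{ij}:M_n(\mathbb C)\to M_n(\mathbb C)$, acting on column vectors in $M_n(\mathbb C)^k$; products are block matrix products, $(\hat A\hat B)_{ij}=\sum_{l}\hat A_{il}\hat B_{lj}$ (composition of maps), and $\hat I$ is the identity. $\hat A_{ij}\rho$ denotes $\hat A_{ij}(\rho)$. The block representation of $\Phi$ is $\hat\Phi=(\hat\Phi_{ij})$,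 $\hat\Phi_{ij}=M_{B_{ij}}$. Ergodicity. $\hat\Omega$ is the block operator all of whose blocks $\hat\Omega_{pq}$, $p,q=1,\dots,k$, are equal to $X\mapsto\frac{1}{kn}\mathrm{Tr}(X)I_n$ (with respect to row-stacking vectorization, its matrix is $\frac1{kn}\sum_{a,b=1}^nE_{ab}\otimes E_{ab}$ with $E_{ab}\in M_n(\mathbb C)$ the matrix units). $\Phi$ is called ergodic if $\hat\Phi^r\to\hat\Omega$ as $r\to\infty$ (entrywise convergence of matrix representations). Fundamental matrix. For $\Phi$ ergodic, $\hat{\mathcal Z}:=\hat I+\sum_{r\ge1}(\hat\Phi^r-\hat\Omega)=(\hat I-\hat\Phi+\hat\Omega)^{-1}$. Mean hitting time operator. For $r\ge1$ let $\pi(i\leftarrow j;r)$ be the collection of products $C=B_{i_r i_{r-1}}\cdots B_{i_2i_1}B_{i_1i_0}$, one for each sequence of sites with $i_0=j$, $i_r=i$ and $i_1,\dots,i_{r-1}\neq i$ (first visit to $i$ after time $0$ at step $r$; for $i=j$, first return). Then $\hat K=(\hat k_{ij})_{i,j=1}^k$ with $\hat k_{ij}:=\sum_{r\ge1} r\sum_{C\in\pi(i\leftarrow j;r)}M_C$. A density matrix is a positive semidefinite $\rho\in M_n(\mathbb C)$ with $\mathrm{Tr}(\rho)=1$. *)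

theory Defs
  imports "HOL-Analysis.Analysis"
begin

text \<open>Sites are the elements of a finite type 'k and the internal degree of freedom is indexed by
  a finite type 'n, so k = CARD('k) and n = CARD('n).\<close>

definition conj_transpose :: "complex^'n^'m \<Rightarrow> complex^'m^'n" where
  "conj_transpose A = (\<chi> i j. cnj (A $ j $ i))"

definition matrix_unit :: "'n \<Rightarrow> 'n \<Rightarrow> complex^'n^'n" where
  "matrix_unit a b = (\<chi> c d. if c = a \<and> d = b then 1 else 0)"

definition density_matrix :: "complex^'n^'n \<Rightarrow> bool" where
  "density_matrix \<rho> \<longleftrightarrow>
     conj_transpose \<rho> = \<rho> \<and>
     (\<forall>v :: complex^'n. 0 \<le> Re (\<Sum>a\<in>UNIV. \<Sum>b\<in>UNIV. cnj (v $ a) * \<rho> $ a $ b * v $ b)) \<and>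
     trace \<rho> = 1"


section \<open>Block operators\<close>

text \<open>The library's type of bounded linear maps is over the reals. All operators used below are
  built from complex-linear maps by sums, compositions, real multiples and limits, hence are
  complex-linear. As everything is finite-dimensional, limits and infinite sums in the norm of
  this type are the same as entrywise ones.\<close>

type_synonym ('n, 'k) block_op = "((complex^'n^'n) \<Rightarrow>\<^sub>L (complex^'n^'n))^'k^'k"

lemma bounded_linear_conj:
  fixes C :: "complex^'n^'n"
  shows "bounded_linear (\<lambda>X. C ** X ** conj_transpose C)"
proof -
  have "linear (\<lambda>X. C ** X ** conj_transpose C)"
    by (rule linearI)
      (simp_all add: vec_eq_iff matrix_matrix_mult_def sum.distrib distrib_left distrib_right
        flip: scaleR_sum_right)
  then show ?thesis
    by (simp add: linear_conv_bounded_linear)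
qed

lift_definition conj_map :: "complex^'n^'n \<Rightarrow> (complex^'n^'n) \<Rightarrow>\<^sub>L (complex^'n^'n)"
  is "\<lambda>C X. C ** X ** conj_transpose C"
  by (rule bounded_linear_conj)

definition block_mult :: "('n::finite, 'k::finite) block_op \<Rightarrow> ('n, 'k) block_op \<Rightarrow> ('n, 'k) block_op" where
  "block_mult A B = (\<chi> i j. \<Sum>l\<in>UNIV. (A $ i $ l) o\<^sub>L (B $ l $ j))"

definition block_id :: "('n::finite, 'k::finite) block_op" where
  "block_id = (\<chi> i j. if i = j then id_blinfun else 0)"

primrec block_pow :: "('n::finite, 'k::finite) block_op \<Rightarrow> nat \<Rightarrow> ('n, 'k) block_op" where
  "block_pow A 0 = block_id"
| "block_pow A (Suc r) = block_mult A (block_pow A r)"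

definition block_diag :: "('n::finite, 'k::finite) block_op \<Rightarrow> ('n, 'k) block_op" where
  "block_diag A = (\<chi> i j. if i = j then A $ i $ i else 0)"


section \<open>Open quantum random walks\<close>

text \<open>A walk is given by B, where B i j is the effect of passing from site j to site i.\<close>

definition oqw :: "('k::finite \<Rightarrow> 'k \<Rightarrow> complex^'n^'n) \<Rightarrow> bool" where
  "oqw B \<longleftrightarrow> (\<forall>j. (\<Sum>i\<in>UNIV. conj_transpose (B i j) ** B i j) = mat 1)"

definition block_rep :: "('k::finite \<Rightarrow> 'k \<Rightarrow> complex^'n^'n) \<Rightarrow> ('n::finite, 'k) block_op" where
  "block_rep B = (\<chi> i j. conj_map (B i j))"

lemma bounded_linear_avg:
  "bounded_linear (\<lambda>X :: complex^'n^'n. mat (trace X / of_nat m) :: complex^'n^'n)"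
proof -
  have "linear (\<lambda>X :: complex^'n^'n. mat (trace X / of_nat m) :: complex^'n^'n)"
    by (rule linearI)
      (simp_all add: vec_eq_iff mat_def trace_def sum.distrib add_divide_distrib
        scaleR_conv_of_real[where 'a = complex] flip: sum_distrib_left)
  then show ?thesis
    by (simp add: linear_conv_bounded_linear)
qed

lift_definition avg_map :: "nat \<Rightarrow> (complex^'n^'n) \<Rightarrow>\<^sub>L (complex^'n^'n)"
  is "\<lambda>m X. mat (trace X / of_nat m)"
  by (rule bounded_linear_avg)

definition omega :: "('n::finite, 'k::finite) block_op" where
  "omega = (\<chi> i j. avg_map (CARD('k) * CARD('n)))"

text \<open>Entrywise convergence of the matrix representations with respect to the matrix units.\<close>

definition ergodic :: "('k::finite \<Rightarrow> 'k \<Rightarrow> complex^'n^'n) \<Rightarrow> bool" where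
  "ergodic B \<longleftrightarrow>
     (\<forall>p q a b c d.
        (\<lambda>r. blinfun_apply (block_pow (block_rep B) r $ p $ q) (matrix_unit a b) $ c $ d)
          \<longlonglongrightarrow> blinfun_apply (omega $ p $ q) (matrix_unit a b) $ c $ d)"

definition fundamental :: "('k::finite \<Rightarrow> 'k \<Rightarrow> complex^'n^'n) \<Rightarrow> ('n::finite, 'k) block_op" where
  "fundamental B = block_id + (\<Sum>r. block_pow (block_rep B) (Suc r) - omega)"


section \<open>Mean hitting times\<close>

text \<open>The sequences i0, ..., ir of sites from j to i whose first visit to i after time 0 is at
  step r, as lists of length r + 1.\<close>

definition first_visit_paths :: "'k::finite \<Rightarrow> 'k \<Rightarrow> nat \<Rightarrow> 'k list set" where
  "first_visit_paths i j r =
     {s. length s = Suc r \<and> s ! 0 = j \<and> s ! r = i \<and> (\<forall>t\<in>{1..<r}. s ! t \<noteq> i)}"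

lemma finite_first_visit_paths: "finite (first_visit_paths i j r)"
  by (rule finite_subset[OF _ finite_lists_length_eq[of UNIV "Suc r"]])
    (auto simp: first_visit_paths_def)

fun path_prod :: "('k \<Rightarrow> 'k \<Rightarrow> complex^'n^'n) \<Rightarrow> 'k list \<Rightarrow> complex^'n^'n" where
  "path_prod B (x # y # s) = path_prod B (y # s) ** B y x"
| "path_prod B _ = mat 1"

text \<open>Summing over sequences rather than over the set of their products counts a product once for
  each sequence that yields it.\<close>

definition mean_hitting :: "('k::finite \<Rightarrow> 'k \<Rightarrow> complex^'n^'n) \<Rightarrow> ('n::finite, 'k) block_op" where
  "mean_hitting B =
     (\<chi> i j. \<Sum>r. real (Suc r) *\<^sub>R (\<Sum>s\<in>first_visit_paths i j (Suc r). conj_map (path_prod B s)))"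

end

theory Submission
  imports Defs
begin

text \<open>Fix a target site i and let Q be \<Phi> with row i replaced by zero. Decomposing at the first
  step, row i of \<Phi> Q^r is the operator of the first visits to i at step r + 1, so row i of K is row i
  of \<Phi> V with V = \<Sum> (r + 1) Q^r. Since V - V Q = \<Sum> Q^r, the first-step equation N + D = F + N \<Phi> holds,
  where F is the operator of the total first visits. Multiplying by Z and using (I - \<Phi>) Z = I - \<Omega> gives
  N - N \<Omega> = F Z - D Z. The blocks of F preserve the trace, the columns of Z preserve the
  total trace, and the columns of N \<Omega> are all equal; so taking traces at (i, j) and (i, i), where
  N vanishes, and subtracting gives the formula.

  Convergence: blocks of Q^r are sums of maps X \<mapsto> C X C*, whose norm is controlled by the trace of
  their value at the identity. For some s, \<Phi>^s is so close to \<Omega> that from every site and every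
  state the walk is at i at time s with probability at least 1 / (2k); hence Q^s contracts traces of positive
  matrices, and the powers of Q decay geometrically.\<close>

section \<open>Bilinearity of the matrix product, the trace, and the Euclidean norm\<close>

lemma bounded_bilinear_matrix_mult:
  "bounded_bilinear ((**) :: complex^'n^'n \<Rightarrow> complex^'n^'n \<Rightarrow> complex^'n^'n)"
proof -
  have "bilinear ((**) :: complex^'n^'n \<Rightarrow> complex^'n^'n \<Rightarrow> complex^'n^'n)"
    unfolding bilinear_def
    by (intro conjI allI linearI)
      (simp_all add: vec_eq_iff matrix_matrix_mult_def sum.distrib distrib_left distrib_right
        flip: scaleR_sum_right)
  then show ?thesis
    by (simp add: bilinear_conv_bounded_bilinear)
qed

interpretation matrix_mult: bounded_bilinear
  "(**) :: complex^'n^'n \<Rightarrow> complex^'n^'n \<Rightarrow> complex^'n^'n"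
  by (rule bounded_bilinear_matrix_mult)

interpretation blinfun_compose: bounded_bilinear "(o\<^sub>L)"
  by (rule bounded_bilinear_blinfun_compose)

lemma bounded_linear_trace: "bounded_linear (trace :: complex^'n^'n \<Rightarrow> complex)"
proof -
  have "linear (trace :: complex^'n^'n \<Rightarrow> complex)"
    by (rule linearI) (simp_all add: trace_def sum.distrib flip: scaleR_sum_right)
  then show ?thesis
    by (simp add: linear_conv_bounded_linear)
qed

lemma trace_zero [simp]: "trace (0 :: complex^'n^'n) = 0"
  by (simp add: trace_def)

lemma trace_sum: "trace (\<Sum>x\<in>S. f x) = (\<Sum>x\<in>S. trace (f x :: complex^'n^'n))"
  by (induction S rule: infinite_finite_induct) (simp_all add: trace_add)

lemma trace_mat: "trace (mat c :: complex^'n^'n) = of_nat CARD('n) * c"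
  by (simp add: trace_def mat_def)

lemma conj_transpose_mult:
  "conj_transpose (C ** D) = conj_transpose D ** conj_transpose (C :: complex^'n^'n)"
  by (simp add: vec_eq_iff conj_transpose_def matrix_matrix_mult_def mult.commute)

lemma conj_transpose_mat1 [simp]: "conj_transpose (mat 1 :: complex^'n^'n) = mat 1"
  by (simp add: vec_eq_iff conj_transpose_def mat_def)

lemma norm_matrix_square: "(norm A)\<^sup>2 = (\<Sum>a\<in>UNIV. \<Sum>b\<in>UNIV. (cmod (A $ a $ b))\<^sup>2)"
  for A :: "complex^'n^'m"
  by (simp add: norm_vec_def L2_set_def sum_nonneg)

lemma norm_conj_transpose [simp]: "norm (conj_transpose A) = norm A" for A :: "complex^'n^'m"
proof -
  have "(norm (conj_transpose A))\<^sup>2 = (norm A)\<^sup>2"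
    unfolding norm_matrix_square conj_transpose_def by (subst sum.swap) simp
  then show ?thesis by simp
qed

text \<open>Both sides are the sum of the squared moduli of the entries. This identity is the source
  of all bounds of norms by traces below.\<close>

lemma trace_gram: "trace (A ** conj_transpose A) = complex_of_real ((norm A)\<^sup>2)"
  for A :: "complex^'n^'n"
  by (simp add: norm_matrix_square trace_def matrix_matrix_mult_def conj_transpose_def
      complex_norm_square flip: of_real_power)

subsection \<open>Positive matrices and completely positive maps\<close>

text \<open>Positive semidefinite matrices, generated as finite sums of Gram matrices: induction
  over the summands then replaces spectral arguments.\<close>

inductive gram_sum :: "complex^'n^'n \<Rightarrow> bool" where
  zero: "gram_sum 0"
| add: "gram_sum X \<Longrightarrow> gram_sum ((A :: complex^'n^'n) ** conj_transpose A + X)"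

text \<open>Completely positive maps, given by their Kraus decompositions for the same
  reason.\<close>

inductive kraus_sum :: "((complex^'n^'n) \<Rightarrow>\<^sub>L (complex^'n^'n)) \<Rightarrow> bool" where
  zero: "kraus_sum 0"
| add: "kraus_sum P \<Longrightarrow> kraus_sum (conj_map C + P)"

lemma gram_sum_plus: "gram_sum X \<Longrightarrow> gram_sum Y \<Longrightarrow> gram_sum (X + Y)"
  by (induction rule: gram_sum.induct) (auto simp: add.assoc intro: gram_sum.intros)

lemma kraus_sum_plus: "kraus_sum P \<Longrightarrow> kraus_sum Q \<Longrightarrow> kraus_sum (P + Q)"
  by (induction rule: kraus_sum.induct) (auto simp: add.assoc intro: kraus_sum.intros)

lemma kraus_sum_sum: "(\<And>x. x \<in> S \<Longrightarrow> kraus_sum (f x)) \<Longrightarrow> kraus_sum (\<Sum>x\<in>S. f x)"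
  by (induction S rule: infinite_finite_induct) (auto intro: kraus_sum.zero kraus_sum_plus)

lemma kraus_sum_conj_map: "kraus_sum (conj_map C)"
  using kraus_sum.add[OF kraus_sum.zero] by simp

lemma gram_sum_mat1: "gram_sum (mat 1)"
  using gram_sum.add[OF gram_sum.zero, of "mat 1"] by simp

lemma conj_map_mat1: "conj_map (mat 1) = id_blinfun"
  by (rule blinfun_eqI) (simp add: conj_map.rep_eq)

lemma conj_map_compose: "conj_map C o\<^sub>L conj_map D = conj_map (C ** D)"
  by (rule blinfun_eqI) (simp add: conj_map.rep_eq conj_transpose_mult matrix_mul_assoc)

lemma kraus_sum_compose:
  assumes "kraus_sum P" "kraus_sum Q"
  shows "kraus_sum (P o\<^sub>L Q)"
proof -
  have *: "kraus_sum (conj_map C o\<^sub>L Q)" for C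
    using assms(2)
    by induction (auto simp: blinfun_compose.add_right blinfun_compose.zero_right conj_map_compose
        intro: kraus_sum.intros)
  show ?thesis
    using assms(1)
    by induction (auto simp: blinfun_compose.add_left blinfun_compose.zero_left intro: kraus_sum.zero kraus_sum_plus *)
qed

text \<open>Conjugation by C sends the Gram matrix of A to the Gram matrix of C A, and everything
  else is additive.\<close>

lemma gram_sum_kraus:
  assumes "kraus_sum P" "gram_sum X"
  shows "gram_sum (P X)"
proof -
  have *: "gram_sum (conj_map C X)" for C
    using assms(2)
  proof induction
    case (add X A)
    have "conj_map C (A ** conj_transpose A) = (C ** A) ** conj_transpose (C ** A)"
      by (simp add: conj_map.rep_eq conj_transpose_mult matrix_mul_assoc)
    then show ?case
      using add by (simp add: blinfun.add_right gram_sum.add)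
  qed (simp add: blinfun.zero_right gram_sum.zero)
  show ?thesis
    using assms(1)
    by induction (auto simp: blinfun.add_left intro: gram_sum.zero gram_sum_plus *)
qed

lemma gram_sum_trace_nonneg: "gram_sum X \<Longrightarrow> 0 \<le> Re (trace X)"
  by (induction rule: gram_sum.induct) (auto simp: trace_add trace_gram)

lemma gram_sum_norm_le_trace:
  obtains K where "K > 0" "\<And>X :: complex^'n^'n. gram_sum X \<Longrightarrow> norm X \<le> K * Re (trace X)"
proof -
  obtain K where K: "K > 0" "\<And>A B. norm (A ** B :: complex^'n^'n) \<le> norm A * norm (B :: complex^'n^'n) * K"
    using matrix_mult.pos_bounded by blast
  have "norm X \<le> K * Re (trace X)" if "gram_sum X" for X :: "complex^'n^'n"
    using that
  proof induction
    case (add X A)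
    have "norm (A ** conj_transpose A + X) \<le> norm (A ** conj_transpose A) + norm X"
      by (rule norm_triangle_ineq)
    also have "\<dots> \<le> K * (norm A)\<^sup>2 + K * Re (trace X)"
      using K(2)[of A "conj_transpose A"] add by (simp add: power2_eq_square mult_ac)
    finally show ?case
      by (simp add: trace_add trace_gram distrib_left del: of_real_power)
  qed simp
  with K(1) show ?thesis by (rule that)
qed

text \<open>Conjugation by C has norm at most a constant times the squared norm of C, which is the
  trace of its value at the identity. That trace is additive in the map, whereas the norm is
  subadditive.\<close>

lemma kraus_sum_norm_le_trace:
  obtains K where "K > 0"
    "\<And>P :: (complex^'n^'n) \<Rightarrow>\<^sub>L (complex^'n^'n). kraus_sum P \<Longrightarrow> norm P \<le> K * Re (trace (P (mat 1)))"
proof -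
  obtain K where K: "K > 0" "\<And>A B. norm (A ** B :: complex^'n^'n) \<le> norm A * norm (B :: complex^'n^'n) * K"
    using matrix_mult.pos_bounded by blast
  have conj: "norm (conj_map C) \<le> K\<^sup>2 * (norm C)\<^sup>2" for C :: "complex^'n^'n"
  proof (rule norm_blinfun_bound)
    fix X :: "complex^'n^'n"
    have "norm (C ** X ** conj_transpose C) \<le> norm (C ** X) * norm C * K"
      using K(2)[of "C ** X" "conj_transpose C"] by simp
    also have "\<dots> \<le> norm C * norm X * K * norm C * K"
      using K by (intro mult_right_mono) auto
    finally show "norm (conj_map C X) \<le> K\<^sup>2 * (norm C)\<^sup>2 * norm X"
      by (simp add: conj_map.rep_eq power2_eq_square mult_ac)
  qed simp
  have "norm P \<le> K\<^sup>2 * Re (trace (P (mat 1)))"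
    if "kraus_sum P" for P :: "(complex^'n^'n) \<Rightarrow>\<^sub>L (complex^'n^'n)"
    using that
  proof induction
    case (add P C)
    have "norm (conj_map C + P) \<le> K\<^sup>2 * (norm C)\<^sup>2 + K\<^sup>2 * Re (trace (P (mat 1)))"
      using norm_triangle_ineq[of "conj_map C" P] conj[of C] add by linarith
    then show ?case
      by (simp add: blinfun.add_left trace_add conj_map.rep_eq trace_gram distrib_left del: of_real_power)
  qed simp
  moreover have "K\<^sup>2 > 0" using K(1) by simp
  ultimately show ?thesis using that by blast
qed

lemma mat_mult_commute: "mat c ** X = X ** mat c" for X :: "complex^'n^'n"
  by (simp add: vec_eq_iff matrix_matrix_mult_def mat_def if_distrib if_distribR sum.delta sum.delta' mult.commute
      cong: if_cong)

text \<open>Multiplication by a scalar matrix expresses complex linearity.\<close>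

lemma kraus_sum_complex_linear:
  "kraus_sum P \<Longrightarrow> P (mat c ** X) = mat c ** P X"
proof (induction rule: kraus_sum.induct)
  case (add P C)
  have "conj_map C (mat c ** X) = mat c ** conj_map C X"
    by (simp add: conj_map.rep_eq matrix_mul_assoc) (simp add: mat_mult_commute)
  with add show ?case
    by (simp add: blinfun.add_left matrix_add_ldistrib)
qed (simp add: matrix_mult.zero_right)

subsection \<open>Block operators\<close>

lemma norm_block_entry_le: "norm (A $ i $ j) \<le> norm A" for A :: "('n::finite, 'k::finite) block_op"
  using Finite_Cartesian_Product.norm_nth_le[of A i] Finite_Cartesian_Product.norm_nth_le[of "A $ i" j]
  by linarith

lemma norm_block_le: "norm A \<le> (\<Sum>i\<in>UNIV. \<Sum>j\<in>UNIV. norm (A $ i $ j))"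
  for A :: "('n::finite, 'k::finite) block_op"
proof -
  have "norm A \<le> (\<Sum>i\<in>UNIV. norm (A $ i))"
    unfolding norm_vec_def[of A] by (rule L2_set_le_sum) simp
  also have "\<dots> \<le> (\<Sum>i\<in>UNIV. \<Sum>j\<in>UNIV. norm (A $ i $ j))"
    by (rule sum_mono) (simp add: norm_vec_def L2_set_le_sum)
  finally show ?thesis .
qed

lemma bounded_bilinear_block_mult:
  "bounded_bilinear (block_mult :: ('n::finite, 'k::finite) block_op \<Rightarrow> _)"
proof
  show "\<exists>K. \<forall>A B :: ('n, 'k) block_op. norm (block_mult A B) \<le> norm A * norm B * K"
  proof (intro exI allI)
    fix A B :: "('n, 'k) block_op"
    have "norm (A $ i $ l o\<^sub>L B $ l $ j) \<le> norm A * norm B" for i l j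
      by (rule order_trans[OF norm_blinfun_compose]) (intro mult_mono norm_block_entry_le norm_ge_zero)
    then have "norm (\<Sum>l\<in>UNIV. A $ i $ l o\<^sub>L B $ l $ j) \<le> (\<Sum>l\<in>(UNIV::'k set). norm A * norm B)" for i j
      by (intro sum_norm_le) auto
    then have "(\<Sum>i\<in>UNIV. \<Sum>j\<in>UNIV. norm (block_mult A B $ i $ j))
        \<le> (\<Sum>i\<in>(UNIV::'k set). \<Sum>j\<in>(UNIV::'k set). \<Sum>l\<in>(UNIV::'k set). norm A * norm B)"
      unfolding block_mult_def by (intro sum_mono) simp
    with norm_block_le[of "block_mult A B"]
    have "norm (block_mult A B) \<le>
        (\<Sum>i\<in>(UNIV::'k set). \<Sum>j\<in>(UNIV::'k set). \<Sum>l\<in>(UNIV::'k set). norm A * norm B)"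
      by linarith
    also have "\<dots> = norm A * norm B * real (CARD('k) ^ 3)"
      by (simp add: power3_eq_cube)
    finally show "norm (block_mult A B) \<le> norm A * norm B * real (CARD('k) ^ 3)" .
  qed
qed (simp_all add: block_mult_def vec_eq_iff blinfun_compose.add_left blinfun_compose.add_right sum.distrib
    blinfun_compose.scaleR_left blinfun_compose.scaleR_right scaleR_sum_right)

interpretation block_mult: bounded_bilinear
  "block_mult :: ('n::finite, 'k::finite) block_op \<Rightarrow> ('n, 'k) block_op \<Rightarrow> ('n, 'k) block_op"
  by (rule bounded_bilinear_block_mult)

lemma block_mult_nth: "block_mult A B $ i $ j = (\<Sum>l\<in>UNIV. A $ i $ l o\<^sub>L B $ l $ j)"
  by (simp add: block_mult_def)

lemma blinfun_compose_id: "id_blinfun o\<^sub>L P = P" "P o\<^sub>L id_blinfun = P"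
  by (auto intro: blinfun_eqI)

lemma block_mult_assoc: "block_mult (block_mult A B) C = block_mult A (block_mult B C)"
proof -
  have assoc: "(P o\<^sub>L Q) o\<^sub>L R = P o\<^sub>L (Q o\<^sub>L R)"
    for P Q R :: "(complex^'a^'a) \<Rightarrow>\<^sub>L (complex^'a^'a)"
    by (rule blinfun_eqI) simp
  have "(\<Sum>l\<in>UNIV. \<Sum>m\<in>UNIV. (A $ i $ m o\<^sub>L B $ m $ l) o\<^sub>L C $ l $ j) =
      (\<Sum>m\<in>UNIV. \<Sum>l\<in>UNIV. A $ i $ m o\<^sub>L (B $ m $ l o\<^sub>L C $ l $ j))" for i j
    by (subst sum.swap) (simp add: assoc)
  then show ?thesis
    by (simp add: vec_eq_iff block_mult_nth blinfun_compose.sum_left blinfun_compose.sum_right)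
qed

lemma block_mult_id_left [simp]: "block_mult block_id A = A"
proof -
  have "(\<Sum>l\<in>UNIV. (if i = l then id_blinfun else 0) o\<^sub>L A $ l $ j) =
      (\<Sum>l\<in>UNIV. if i = l then A $ l $ j else 0)" for i j
    by (rule sum.cong) (auto simp: blinfun_compose.zero_left blinfun_compose_id)
  then show ?thesis
    by (simp add: vec_eq_iff block_mult_nth block_id_def)
qed

lemma block_mult_id_right [simp]: "block_mult A block_id = A"
proof -
  have "(\<Sum>l\<in>UNIV. A $ i $ l o\<^sub>L (if l = j then id_blinfun else 0)) =
      (\<Sum>l\<in>UNIV. if l = j then A $ i $ l else 0)" for i j
    by (rule sum.cong) (auto simp: blinfun_compose.zero_right blinfun_compose_id)
  then show ?thesis
    by (simp add: vec_eq_iff block_mult_nth block_id_def)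
qed

section \<open>Powers of block operators and their geometric decay\<close>

lemma block_pow_add: "block_pow A (r + s) = block_mult (block_pow A r) (block_pow A s)"
  by (induction r) (simp_all add: block_mult_assoc)

lemma block_pow_Suc_right: "block_pow A (Suc r) = block_mult (block_pow A r) A"
  using block_pow_add[of A r 1] by simp

text \<open>A single value below 1 forces geometric decay: removing r from the index costs a factor
  q = x^r, so a n is at most M x^n. The weight n + 1 is then harmless.\<close>

lemma submultiplicative_summable:
  fixes a :: "nat \<Rightarrow> real"
  assumes nonneg: "\<And>n. 0 \<le> a n" and submult: "\<And>m n. a (m + n) \<le> a m * a n"
    and r: "r > 0" "a r < 1"
  shows "summable (\<lambda>n. real (Suc n) * a n)"
proof -
  \<comment> \<open>The maximum keeps q positive even when a r = 0, so that division by powers of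
    its root is possible.\<close>
  define q where "q = max (a r) (1 / 2)"
  define x where "x = root r q"
  \<comment> \<open>Bounds the quotient a m / x^m for all remainders m < r, the base of the
    induction.\<close>
  define M where "M = (\<Sum>m<r. a m / x ^ m)"
  have q: "0 < q" "q < 1" "a r \<le> q" using r by (auto simp: q_def)
  have x: "0 < x" "x < 1" "x ^ r = q" using q r by (auto simp: x_def)
  have bound: "a n / x ^ n \<le> M" for n
  proof (induction n rule: less_induct)
    case (less n)
    show ?case
    proof (cases "n < r")
      case True
      then show ?thesis
        unfolding M_def using x nonneg by (intro member_le_sum) auto
    next
      case False
      define m where "m = n - r"
      have n: "n = m + r" and "m < n" using False r by (auto simp: m_def)
      have "a n \<le> a m * q"
        using submult[of m r] mult_left_mono[OF q(3) nonneg[of m]] by (simp add: n)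
      then have "a n / x ^ n \<le> (a m * q) / (x ^ m * q)"
        unfolding n power_add x(3) using x q by (intro divide_right_mono) simp_all
      also have "\<dots> = a m / x ^ m" using q by simp
      also have "\<dots> \<le> M" by (rule less.IH[OF \<open>m < n\<close>])
      finally show ?thesis .
    qed
  qed
  have "summable (\<lambda>n. M * (real (Suc n) * x ^ n))"
    using geometric_deriv_sums[of x] x by (intro summable_mult) (auto simp: sums_iff)
  then show ?thesis
  proof (rule summable_comparison_test')
    fix n
    have "a n \<le> M * x ^ n" using bound[of n] x by (simp add: field_simps)
    then have "real (Suc n) * a n \<le> real (Suc n) * (M * x ^ n)"
      by (rule mult_left_mono) simp
    then show "norm (real (Suc n) * a n) \<le> M * (real (Suc n) * x ^ n)"
      using nonneg[of n] by (simp add: mult_ac)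
  qed
qed

text \<open>The norm is submultiplicative for \<open>block_mult\<close> only up to a constant K, so
  the decay argument is applied to K times the norm. Since K is not explicit, the hypothesis asks
  for arbitrarily small powers.\<close>

lemma block_pow_summable:
  fixes A :: "('n::finite, 'k::finite) block_op"
  assumes "\<And>e. e > 0 \<Longrightarrow> \<exists>r>0. norm (block_pow A r) < e"
  shows "summable (\<lambda>r. real (Suc r) * norm (block_pow A r))"
proof -
  obtain K where K: "K > 0"
    "\<And>A B :: ('n, 'k) block_op. norm (block_mult A B) \<le> norm A * norm B * K"
    using block_mult.pos_bounded by blast
  obtain r where r: "r > 0" "norm (block_pow A r) < 1 / K"
    using assms[of "1 / K"] K(1) by auto
  have "summable (\<lambda>r. real (Suc r) * (K * norm (block_pow A r)))"
  proof (rule submultiplicative_summable[OF _ _ r(1)])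
    show "K * norm (block_pow A (m + n)) \<le> K * norm (block_pow A m) * (K * norm (block_pow A n))" for m n
      using mult_left_mono[OF K(2)[of "block_pow A m" "block_pow A n"], of K] K(1)
      by (simp add: block_pow_add mult_ac)
  qed (use K r in \<open>auto simp: field_simps\<close>)
  then have "summable (\<lambda>r. inverse K * (real (Suc r) * (K * norm (block_pow A r))))"
    by (rule summable_mult)
  moreover have "inverse K * (real (Suc r) * (K * norm (block_pow A r))) =
      real (Suc r) * norm (block_pow A r)" for r
    using K(1) by simp
  ultimately show ?thesis by (simp only:)
qed

section \<open>Complex linearity and matrix units\<close>

lemma mat_mult_nth: "(mat c ** X) $ p $ q = c * X $ p $ q" for X :: "complex^'n^'n"
proof -
  have "(mat c ** X) $ p $ q = (\<Sum>e\<in>UNIV. if p = e then c * X $ e $ q else 0)"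
    unfolding matrix_matrix_mult_def mat_def vec_lambda_beta by (rule sum.cong) auto
  then show ?thesis by simp
qed

lemma trace_mat_mult: "trace (mat c ** X) = c * trace X" for X :: "complex^'n^'n"
  by (simp add: trace_def mat_mult_nth sum_distrib_left)

lemma matrix_unit_expansion:
  "X = (\<Sum>a\<in>UNIV. \<Sum>b\<in>UNIV. mat (X $ a $ b) ** matrix_unit a b)" for X :: "complex^'n^'n"
proof -
  have "(mat x ** matrix_unit a b) $ c $ d = (if b = d then if a = c then x else 0 else 0)"
    for x and a b c d :: 'n
    by (auto simp: mat_mult_nth matrix_unit_def)
  then show ?thesis
    by (simp add: vec_eq_iff)
qed

text \<open>Passes from entrywise convergence, as in \<open>ergodic\<close>, to norm convergence.
  Complex linearity must be assumed because the maps are only real-linear by type, and matrix units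
  span the matrices only over the complex numbers.\<close>

lemma complex_linear_tendsto:
  fixes P :: "nat \<Rightarrow> (complex^'n^'n) \<Rightarrow>\<^sub>L (complex^'n^'n)"
    and Q :: "(complex^'n^'n) \<Rightarrow>\<^sub>L (complex^'n^'n)"
  assumes P: "\<And>r c X. P r (mat c ** X) = mat c ** P r X"
    and Q: "\<And>c X. Q (mat c ** X) = mat c ** Q X"
    and lim: "\<And>a b c d. (\<lambda>r. P r (matrix_unit a b) $ c $ d) \<longlonglongrightarrow> Q (matrix_unit a b) $ c $ d"
  shows "P \<longlonglongrightarrow> Q"
\<comment> \<open>In finite dimension pointwise convergence of linear maps is convergence in
  norm.\<close>
proof (rule tendsto_componentwise1)
  fix X :: "complex^'n^'n"
  have expand: "R X $ c $ d = (\<Sum>a\<in>UNIV. \<Sum>b\<in>UNIV. X $ a $ b * R (matrix_unit a b) $ c $ d)"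
    if "\<And>c X. R (mat c ** X) = mat c ** R X"
    for R :: "(complex^'n^'n) \<Rightarrow>\<^sub>L (complex^'n^'n)" and c d
    by (subst matrix_unit_expansion[of X])
      (simp add: blinfun.sum_right that mat_mult_nth)
  show "(\<lambda>r. P r X) \<longlonglongrightarrow> Q X"
  proof (intro vec_tendstoI)
    show "(\<lambda>r. P r X $ c $ d) \<longlonglongrightarrow> Q X $ c $ d" for c d
      unfolding expand[OF P] expand[OF Q] by (intro tendsto_intros lim)
  qed
qed

lemma kraus_sum_block_mult:
  "(\<And>p q. kraus_sum (A $ p $ q)) \<Longrightarrow> (\<And>p q. kraus_sum (C $ p $ q)) \<Longrightarrow>
    kraus_sum (block_mult A C $ p $ q)"
  by (simp add: block_mult_nth kraus_sum_sum kraus_sum_compose)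

lemma kraus_sum_id: "kraus_sum id_blinfun"
  unfolding conj_map_mat1[symmetric] by (rule kraus_sum_conj_map)

lemma kraus_sum_block_pow:
  assumes "\<And>p q. kraus_sum (A $ p $ q)"
  shows "kraus_sum (block_pow A r $ p $ q)"
proof (induction r arbitrary: p q)
  case 0
  show ?case by (simp add: block_id_def kraus_sum.zero kraus_sum_id)
qed (simp add: kraus_sum_block_mult assms)

lemma omega_apply:
  "blinfun_apply ((omega :: ('n::finite, 'k::finite) block_op) $ p $ q) X =
    mat (trace X / of_nat (CARD('k) * CARD('n)))"
  by (simp add: omega_def avg_map.rep_eq)

lemma trace_omega:
  "trace (blinfun_apply ((omega :: ('n::finite, 'k::finite) block_op) $ p $ q) X) =
    trace X / of_nat CARD('k)"
  by (simp add: omega_apply trace_mat)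

subsection \<open>Ergodic walks\<close>

locale ergodic_oqw =
  fixes B :: "'k::finite \<Rightarrow> 'k \<Rightarrow> complex^'n^'n"
  assumes oqw: "oqw B" and ergodic: "ergodic B"
begin

abbreviation \<Phi> :: "('n, 'k) block_op" where "\<Phi> \<equiv> block_rep B"
abbreviation \<Omega> :: "('n, 'k) block_op" where "\<Omega> \<equiv> omega"

text \<open>Cyclicity of the trace turns the sum into the normalization condition of the
  walk.\<close>

lemma trace_column: "(\<Sum>l\<in>UNIV. trace ((\<Phi> $ l $ j) X)) = trace X"
proof -
  have "trace ((\<Phi> $ l $ j) X) = trace (conj_transpose (B l j) ** B l j ** X)" for l
    using trace_mul_sym[of "B l j ** X" "conj_transpose (B l j)"]
    by (simp add: block_rep_def conj_map.rep_eq matrix_mul_assoc)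
  then have "(\<Sum>l\<in>UNIV. trace ((\<Phi> $ l $ j) X)) =
      trace ((\<Sum>l\<in>UNIV. conj_transpose (B l j) ** B l j) ** X)"
    by (simp add: matrix_mult.sum_left trace_sum)
  then show ?thesis
    using oqw by (simp add: oqw_def)
qed

lemma kraus_sum_rep: "kraus_sum (\<Phi> $ p $ q)"
  by (simp add: block_rep_def kraus_sum_conj_map)

lemma pow_tendsto: "block_pow \<Phi> \<longlonglongrightarrow> \<Omega>"
proof (intro vec_tendstoI)
  fix p q
  show "(\<lambda>r. block_pow \<Phi> r $ p $ q) \<longlonglongrightarrow> \<Omega> $ p $ q"
  proof (rule complex_linear_tendsto)
    show "(block_pow \<Phi> r $ p $ q) (mat c ** X) = mat c ** (block_pow \<Phi> r $ p $ q) X" for r c X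
      by (intro kraus_sum_complex_linear kraus_sum_block_pow kraus_sum_rep)
    show "(\<Omega> $ p $ q) (mat c ** X) = mat c ** (\<Omega> $ p $ q) X" for c X
      by (simp add: omega_apply trace_mat_mult vec_eq_iff mat_mult_nth) (simp add: mat_def)
  qed (use ergodic in \<open>simp add: ergodic_def\<close>)
qed

text \<open>Shifting the sequence of powers by one step does not change its limit.\<close>

lemma rep_omega: "block_mult \<Phi> \<Omega> = \<Omega>"
proof (rule LIMSEQ_unique)
  show "(\<lambda>r. block_pow \<Phi> (Suc r)) \<longlonglongrightarrow> block_mult \<Phi> \<Omega>"
    by (simp add: block_mult.tendsto pow_tendsto)
  show "(\<lambda>r. block_pow \<Phi> (Suc r)) \<longlonglongrightarrow> \<Omega>"
    by (rule LIMSEQ_Suc) (rule pow_tendsto)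
qed

lemma omega_rep: "block_mult \<Omega> \<Phi> = \<Omega>"
proof (rule LIMSEQ_unique)
  show "(\<lambda>r. block_pow \<Phi> (Suc r)) \<longlonglongrightarrow> block_mult \<Omega> \<Phi>"
    unfolding block_pow_Suc_right by (intro block_mult.tendsto pow_tendsto tendsto_const)
  show "(\<lambda>r. block_pow \<Phi> (Suc r)) \<longlonglongrightarrow> \<Omega>"
    by (rule LIMSEQ_Suc) (rule pow_tendsto)
qed

lemma pow_omega: "block_mult (block_pow \<Phi> r) \<Omega> = \<Omega>"
  by (induction r) (simp_all add: block_mult_assoc rep_omega)

lemma omega_pow: "block_mult \<Omega> (block_pow \<Phi> r) = \<Omega>"
  by (induction r) (simp_all add: omega_rep flip: block_mult_assoc)

lemma omega_omega: "block_mult \<Omega> \<Omega> = \<Omega>"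
proof (rule LIMSEQ_unique)
  show "(\<lambda>r. block_mult (block_pow \<Phi> r) \<Omega>) \<longlonglongrightarrow> block_mult \<Omega> \<Omega>"
    by (intro block_mult.tendsto pow_tendsto tendsto_const)
qed (simp add: pow_omega)

text \<open>\<Omega> is idempotent and absorbs powers of \<Phi>, so the cross terms cancel. Exponent
  0 is excluded: there the left side would be the identity, without the subtracted \<Omega>.\<close>

lemma pow_diff_omega: "block_pow (\<Phi> - \<Omega>) (Suc r) = block_pow \<Phi> (Suc r) - \<Omega>"
proof (induction r)
  case (Suc r)
  have "block_pow (\<Phi> - \<Omega>) (Suc (Suc r)) = block_mult (\<Phi> - \<Omega>) (block_pow \<Phi> (Suc r) - \<Omega>)"
    using Suc by simp
  also have "\<dots> = block_pow \<Phi> (Suc (Suc r)) - \<Omega>"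
    unfolding block_mult.diff_left block_mult.diff_right rep_omega omega_pow omega_omega by simp
  finally show ?case .
qed simp

text \<open>The summands are powers of \<Phi> - \<Omega> that tend to zero, hence decay
  geometrically. This gives the series in \<open>fundamental\<close> its meaning.\<close>

lemma summable_pow_diff: "summable (\<lambda>r. block_pow \<Phi> (Suc r) - \<Omega>)"
proof -
  have "(\<lambda>r. norm (block_pow (\<Phi> - \<Omega>) (Suc r))) \<longlonglongrightarrow> 0"
    unfolding pow_diff_omega
    using LIMSEQ_Suc[OF pow_tendsto] by (simp add: tendsto_norm_zero_iff LIM_zero)
  then have "\<exists>r>0. norm (block_pow (\<Phi> - \<Omega>) r) < e" if "e > 0" for e
    using order_tendstoD(2)[OF _ that] eventually_happens'[OF sequentially_bot] by (metis zero_less_Suc)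
  then have "summable (\<lambda>r. real (Suc r) * norm (block_pow (\<Phi> - \<Omega>) r))"
    by (rule block_pow_summable)
  then have "summable (\<lambda>r. norm (block_pow (\<Phi> - \<Omega>) r))"
    by (rule summable_comparison_test'[where N = 0]) (simp add: mult_le_cancel_right1)
  then have "summable (block_pow (\<Phi> - \<Omega>))"
    by (rule summable_norm_cancel)
  then show ?thesis
    using summable_Suc_iff[of "block_pow (\<Phi> - \<Omega>)"] unfolding pow_diff_omega by simp
qed

text \<open>Multiplication by \<Phi> shifts the series by one term. Together with
  \<open>omega_fundamental\<close> this says that (I - \<Phi> + \<Omega>) Z = I.\<close>

lemma fundamental_equation: "fundamental B - block_mult \<Phi> (fundamental B) = block_id - \<Omega>"
proof -
  let ?f = "\<lambda>r. block_pow \<Phi> (Suc r) - \<Omega>"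
  have "block_mult \<Phi> (\<Sum>r. ?f r) = (\<Sum>r. block_mult \<Phi> (?f r))"
    by (rule bounded_linear.suminf[OF block_mult.bounded_linear_right summable_pow_diff])
  also have "\<dots> = (\<Sum>r. ?f (Suc r))"
    by (simp add: block_mult.diff_right rep_omega)
  also have "\<dots> = (\<Sum>r. ?f r) - ?f 0"
    by (rule suminf_split_head[OF summable_pow_diff])
  finally show ?thesis
    by (simp add: fundamental_def block_mult.add_right)
qed

lemma omega_fundamental: "block_mult \<Omega> (fundamental B) = \<Omega>"
proof -
  have "block_mult \<Omega> (\<Sum>r. block_pow \<Phi> (Suc r) - \<Omega>) = (\<Sum>r. block_mult \<Omega> (block_pow \<Phi> (Suc r) - \<Omega>))"
    by (rule bounded_linear.suminf[OF block_mult.bounded_linear_right summable_pow_diff])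
  also have "\<dots> = 0"
    by (simp add: block_mult.diff_right omega_pow omega_omega del: block_pow.simps)
  finally show ?thesis
    by (simp add: fundamental_def block_mult.add_right)
qed

text \<open>Every row of \<Omega> reads off the total trace of a column, divided by k, so \<Omega> Z
  = \<Omega> is a statement about total traces.\<close>

lemma trace_fundamental_column: "(\<Sum>l\<in>UNIV. trace ((fundamental B $ l $ j) X)) = trace X"
proof -
  have "trace ((block_mult \<Omega> (fundamental B) $ j $ j) X) =
      (\<Sum>l\<in>UNIV. trace ((fundamental B $ l $ j) X)) / of_nat CARD('k)"
    by (simp add: block_mult_nth blinfun.sum_left trace_sum trace_omega sum_divide_distrib)
  then show ?thesis
    by (simp add: omega_fundamental trace_omega)
qed


section \<open>The walk with arrivals at a target site suppressed\<close>

definition taboo :: "'k \<Rightarrow> ('n, 'k) block_op" where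
  "taboo i = (\<chi> l m. if l = i then 0 else \<Phi> $ l $ m)"

lemma taboo_nth: "taboo i $ l $ m = (if l = i then 0 else \<Phi> $ l $ m)"
  by (simp add: taboo_def)

lemma kraus_sum_taboo_pow: "kraus_sum (block_pow (taboo i) r $ p $ q)"
  by (rule kraus_sum_block_pow) (simp add: taboo_nth kraus_sum.zero kraus_sum_rep)

text \<open>The only loss of trace in a step is what would arrive at i. Summed over r, this loss
  telescopes in \<open>trace_first_visit\<close>.\<close>

lemma trace_taboo_pow_Suc:
  "(\<Sum>l\<in>UNIV. trace ((block_pow (taboo i) (Suc r) $ l $ j) X)) =
   (\<Sum>l\<in>UNIV. trace ((block_pow (taboo i) r $ l $ j) X)) -
   trace ((block_mult \<Phi> (block_pow (taboo i) r) $ i $ j) X)"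
proof -
  have column: "(\<Sum>l\<in>UNIV. trace ((taboo i $ l $ m) Y)) = trace Y - trace ((\<Phi> $ i $ m) Y)" for m Y
  proof -
    have "(\<Sum>l\<in>UNIV. trace ((taboo i $ l $ m) Y)) =
        (\<Sum>l\<in>UNIV. trace ((\<Phi> $ l $ m) Y) - (if l = i then trace ((\<Phi> $ i $ m) Y) else 0))"
      by (rule sum.cong) (auto simp: taboo_nth)
    then show ?thesis by (simp add: sum_subtractf trace_column)
  qed
  have "(\<Sum>l\<in>UNIV. trace ((block_pow (taboo i) (Suc r) $ l $ j) X)) =
      (\<Sum>m\<in>UNIV. \<Sum>l\<in>UNIV. trace ((taboo i $ l $ m) ((block_pow (taboo i) r $ m $ j) X)))"
    by (simp add: block_mult_nth blinfun.sum_left trace_sum) (rule sum.swap)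
  then show ?thesis
    by (simp add: column sum_subtractf block_mult_nth blinfun.sum_left trace_sum)
qed

lemma trace_pow_column: "(\<Sum>l\<in>UNIV. trace ((block_pow \<Phi> r $ l $ j) X)) = trace X"
proof (induction r)
  case 0
  have "trace ((block_pow \<Phi> 0 $ l $ j) X) = (if l = j then trace X else 0)" for l
    by (simp add: block_id_def)
  then show ?case by simp
next
  case (Suc r)
  have "(\<Sum>l\<in>UNIV. trace ((block_pow \<Phi> (Suc r) $ l $ j) X)) =
      (\<Sum>m\<in>UNIV. \<Sum>l\<in>UNIV. trace ((\<Phi> $ l $ m) ((block_pow \<Phi> r $ m $ j) X)))"
    by (simp add: block_mult_nth blinfun.sum_left trace_sum) (rule sum.swap)
  with Suc show ?case by (simp add: trace_column)
qed

text \<open>With Q for \<open>taboo i\<close>, the difference at r + 1 splits as Q (\<Phi>^r - Q^r)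
  + (\<Phi> - Q) \<Phi>^r, where all factors have completely positive blocks. Hence Q^r never
  carries more trace than \<Phi>^r on positive matrices.\<close>

lemma kraus_sum_pow_diff_taboo_pow: "kraus_sum ((block_pow \<Phi> r - block_pow (taboo i) r) $ p $ q)"
proof (induction r arbitrary: p q)
  case (Suc r)
  have "block_pow \<Phi> (Suc r) - block_pow (taboo i) (Suc r) =
      block_mult (taboo i) (block_pow \<Phi> r - block_pow (taboo i) r) +
      block_mult (\<Phi> - taboo i) (block_pow \<Phi> r)"
    by (simp add: block_mult.diff_left block_mult.diff_right)
  moreover have "kraus_sum (taboo i $ p $ q)" "kraus_sum ((\<Phi> - taboo i) $ p $ q)" for p q
    by (auto simp: taboo_nth kraus_sum.zero kraus_sum_rep)
  ultimately show ?case
    using Suc by (simp only: vector_add_component)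
      (intro kraus_sum_plus kraus_sum_block_mult kraus_sum_block_pow kraus_sum_rep)
qed (simp add: kraus_sum.zero)

lemma taboo_pow_contraction:
  obtains r where "r > 0" "\<And>i j X. gram_sum X \<Longrightarrow>
    (\<Sum>l\<in>UNIV. Re (trace ((block_pow (taboo i) r $ l $ j) X))) \<le>
      (1 - 1 / (2 * real CARD('k))) * Re (trace X)"
proof -
  let ?k = "real CARD('k)"
  obtain K where K: "K > 0" "\<And>X :: complex^'n^'n. gram_sum X \<Longrightarrow> norm X \<le> K * Re (trace X)"
    using gram_sum_norm_le_trace by blast
  have "\<exists>T>0. \<forall>X :: complex^'n^'n. norm (trace X) \<le> norm X * T"
    by (rule bounded_linear.pos_bounded) (rule bounded_linear_trace)
  then obtain T where T: "T > 0" "\<And>X :: complex^'n^'n. norm (trace X) \<le> norm X * T"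
    by blast
  \<comment> \<open>Chosen so that replacing \<Phi>^r by \<Omega> changes the trace at a site by at
    most 1 / (2k) of the trace of X, half of the limiting share 1 / k.\<close>
  define e where "e = 1 / (2 * ?k * T * K)"
  have e: "e > 0" "e * T * K = 1 / (2 * ?k)"
    using K(1) T(1) by (simp_all add: e_def)
  have "(\<lambda>r. norm (block_pow \<Phi> (Suc r) - \<Omega>)) \<longlonglongrightarrow> 0"
    using LIMSEQ_Suc[OF pow_tendsto] by (simp add: tendsto_norm_zero_iff LIM_zero)
  then obtain s where s: "norm (block_pow \<Phi> (Suc s) - \<Omega>) < e"
    using order_tendstoD(2)[OF _ e(1)] eventually_happens'[OF sequentially_bot] by blast
  let ?r = "Suc s"
  have "(\<Sum>l\<in>UNIV. Re (trace ((block_pow (taboo i) ?r $ l $ j) X))) \<le> (1 - 1 / (2 * ?k)) * Re (trace X)"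
    if X: "gram_sum X" for i j X
  proof -
    \<comment> \<open>The leftmost factor has zero row i. The remaining trace thus sits at the other
      sites, where \<Phi> dominates and has already given up its share at i.\<close>
    have row: "block_pow (taboo i) ?r $ i $ j = 0"
      by (simp add: block_mult_nth taboo_nth blinfun_compose.zero_left)
    let ?d = "((block_pow \<Phi> ?r - \<Omega>) $ i $ j) X"
    have "norm ?d \<le> norm ((block_pow \<Phi> ?r - \<Omega>) $ i $ j) * norm X"
      by (rule norm_blinfun)
    also have "\<dots> \<le> e * (K * Re (trace X))"
      using s norm_block_entry_le[of "block_pow \<Phi> ?r - \<Omega>" i j] K(2)[OF X] e(1)
      by (intro mult_mono) auto
    finally have "norm (trace ?d) \<le> e * (K * Re (trace X)) * T"
      using T(1) by (intro order_trans[OF T(2)] mult_right_mono) auto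
    also have "\<dots> = (e * T * K) * Re (trace X)" by (simp add: mult_ac)
    also have "\<dots> = 1 / (2 * ?k) * Re (trace X)" unfolding e(2) ..
    finally have "\<bar>Re (trace ?d)\<bar> \<le> 1 / (2 * ?k) * Re (trace X)"
      using abs_Re_le_cmod order_trans by blast
    moreover have "Re (trace ?d) = Re (trace ((block_pow \<Phi> ?r $ i $ j) X)) - Re (trace X) / ?k"
      by (simp add: blinfun.diff_left trace_sub trace_omega del: block_pow.simps)
    ultimately have hit: "1 / (2 * ?k) * Re (trace X) \<le> Re (trace ((block_pow \<Phi> ?r $ i $ j) X))"
      by (simp add: abs_le_iff field_simps)
    have le: "Re (trace ((block_pow (taboo i) ?r $ l $ j) X)) \<le> Re (trace ((block_pow \<Phi> ?r $ l $ j) X))" for l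
      using gram_sum_trace_nonneg[OF gram_sum_kraus[OF kraus_sum_pow_diff_taboo_pow[of ?r i l j] X]]
      by (simp add: blinfun.diff_left trace_sub del: block_pow.simps)
    have "(\<Sum>l\<in>UNIV. Re (trace ((block_pow (taboo i) ?r $ l $ j) X))) =
        (\<Sum>l\<in>UNIV - {i}. Re (trace ((block_pow (taboo i) ?r $ l $ j) X)))"
      using row by (subst sum.remove[of _ i]) (simp_all del: block_pow.simps)
    also have "\<dots> \<le> (\<Sum>l\<in>UNIV - {i}. Re (trace ((block_pow \<Phi> ?r $ l $ j) X)))"
      by (intro sum_mono le)
    also have "\<dots> = Re (\<Sum>l\<in>UNIV. trace ((block_pow \<Phi> ?r $ l $ j) X)) -
        Re (trace ((block_pow \<Phi> ?r $ i $ j) X))"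
      by (subst sum.remove[of UNIV i]) (simp_all del: block_pow.simps)
    also have "\<dots> \<le> (1 - 1 / (2 * ?k)) * Re (trace X)"
      using hit by (simp add: trace_pow_column left_diff_distrib del: block_pow.simps)
    finally show ?thesis .
  qed
  then show ?thesis by (rule that[of ?r, rotated]) simp_all
qed

lemma summable_taboo_pow: "summable (\<lambda>r. real (Suc r) * norm (block_pow (taboo i) r))"
proof (rule block_pow_summable)
  fix e :: real assume e: "e > 0"
  let ?k = "real CARD('k)"
  let ?q = "1 - 1 / (2 * ?k)"
  have "1 \<le> ?k" by (simp add: Suc_le_eq)
  then have "1 \<le> ?k * 2" by linarith
  then have q: "0 \<le> ?q" "?q < 1" by (simp_all add: field_simps)
  obtain r where r: "r > 0" "\<And>i j X. gram_sum X \<Longrightarrow>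
    (\<Sum>l\<in>UNIV. Re (trace ((block_pow (taboo i) r $ l $ j) X))) \<le> ?q * Re (trace X)"
    using taboo_pow_contraction by blast
  obtain K where K: "K > 0" "\<And>P :: (complex^'n^'n) \<Rightarrow>\<^sub>L (complex^'n^'n). kraus_sum P \<Longrightarrow>
      norm P \<le> K * Re (trace (P (mat 1)))"
    using kraus_sum_norm_le_trace by blast
  \<comment> \<open>The contraction applies again after every r steps, since the intermediate blocks
    are still positive matrices.\<close>
  have iterate: "(\<Sum>l\<in>UNIV. Re (trace ((block_pow (taboo i) (m * r) $ l $ j) X))) \<le> ?q ^ m * Re (trace X)"
    if X: "gram_sum X" for m j X
  proof (induction m)
    case 0
    have "Re (trace ((block_pow (taboo i) 0 $ l $ j) X)) = (if l = j then Re (trace X) else 0)" for l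
      by (simp add: block_id_def)
    then show ?case by simp
  next
    case (Suc m)
    have "(\<Sum>l\<in>UNIV. Re (trace ((block_pow (taboo i) (Suc m * r) $ l $ j) X))) =
        (\<Sum>p\<in>UNIV. \<Sum>l\<in>UNIV. Re (trace ((block_pow (taboo i) r $ l $ p)
          ((block_pow (taboo i) (m * r) $ p $ j) X))))"
      by (simp add: block_pow_add block_mult_nth blinfun.sum_left trace_sum) (rule sum.swap)
    also have "\<dots> \<le> (\<Sum>p\<in>UNIV. ?q * Re (trace ((block_pow (taboo i) (m * r) $ p $ j) X)))"
      by (intro sum_mono r(2) gram_sum_kraus[OF kraus_sum_taboo_pow X])
    also have "\<dots> \<le> ?q * (?q ^ m * Re (trace X))"
      unfolding sum_distrib_left[symmetric] using Suc q(1) by (rule mult_left_mono)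
    finally show ?case by simp
  qed
  let ?c = "?k * (K * real CARD('n))"
  have bound: "norm (block_pow (taboo i) (m * r)) \<le> ?c * ?q ^ m" for m
  proof -
    let ?t = "\<lambda>l j. Re (trace ((block_pow (taboo i) (m * r) $ l $ j) (mat 1)))"
    have "norm (block_pow (taboo i) (m * r)) \<le> (\<Sum>l\<in>UNIV. \<Sum>j\<in>UNIV. K * ?t l j)"
      by (rule order_trans[OF norm_block_le]) (intro sum_mono K(2) kraus_sum_taboo_pow)
    also have "\<dots> = (\<Sum>j\<in>UNIV. K * (\<Sum>l\<in>UNIV. ?t l j))"
      by (subst sum.swap) (simp add: sum_distrib_left)
    also have "\<dots> \<le> (\<Sum>j\<in>(UNIV::'k set). K * (?q ^ m * real CARD('n)))"
      using K(1) iterate[OF gram_sum_mat1] by (intro sum_mono mult_left_mono) (auto simp: trace_I)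
    finally show ?thesis by (simp add: mult_ac)
  qed
  \<comment> \<open>\<open>Suc m\<close> instead of \<open>m\<close> makes the exponent
    \<open>Suc m * r\<close> positive, as the goal requires.\<close>
  have "(\<lambda>m. ?c * ?q ^ Suc m) \<longlonglongrightarrow> ?c * 0"
    using q by (intro tendsto_intros LIMSEQ_Suc[OF LIMSEQ_power_zero]) simp
  then have "\<forall>\<^sub>F m in sequentially. ?c * ?q ^ Suc m < e"
    by (rule order_tendstoD(2)) (use e in simp)
  then obtain m where "?c * ?q ^ Suc m < e"
    by (auto dest: eventually_happens)
  then have "norm (block_pow (taboo i) (Suc m * r)) < e"
    using bound[of "Suc m"] by linarith
  then show "\<exists>r>0. norm (block_pow (taboo i) r) < e"
    using r(1) by (metis mult_pos_pos zero_less_Suc)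
qed

lemma summable_taboo_pow_weighted: "summable (\<lambda>r. real (Suc r) *\<^sub>R block_pow (taboo i) r)"
  by (rule summable_norm_cancel) (use summable_taboo_pow in simp)

lemma summable_taboo_pow_plain: "summable (block_pow (taboo i))"
proof (rule summable_norm_cancel)
  show "summable (\<lambda>r. norm (block_pow (taboo i) r))"
    by (rule summable_comparison_test'[OF summable_taboo_pow[of i], where N = 0])
      (simp add: mult_le_cancel_right1)
qed

subsection \<open>Hitting times\<close>

text \<open>Decomposition at the first step: with at least two steps the second site l must avoid i,
  while the start j may be i itself.\<close>

lemma first_visit_paths_Suc:
  "first_visit_paths i j (Suc (Suc r)) = (\<Union>l\<in>- {i}. (#) j ` first_visit_paths i l (Suc r))"
proof (intro equalityI subsetI)
  fix s assume s: "s \<in> first_visit_paths i j (Suc (Suc r))"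
  then obtain t where t: "s = j # t" "length t = Suc (Suc r)"
    by (cases s) (auto simp: first_visit_paths_def)
  have inner: "s ! m \<noteq> i" if "1 \<le> m" "m < Suc (Suc r)" for m
    using s that by (auto simp: first_visit_paths_def)
  have "t ! m \<noteq> i" if "m < Suc r" for m
    using inner[of "Suc m"] that t by simp
  then have "t \<in> first_visit_paths i (t ! 0) (Suc r)" "t ! 0 \<noteq> i"
    using s t by (auto simp: first_visit_paths_def)
  with t show "s \<in> (\<Union>l\<in>- {i}. (#) j ` first_visit_paths i l (Suc r))" by blast
next
  fix s assume "s \<in> (\<Union>l\<in>- {i}. (#) j ` first_visit_paths i l (Suc r))"
  then obtain l t where t: "s = j # t" "l \<noteq> i" "t \<in> first_visit_paths i l (Suc r)" by blast
  have "s ! m \<noteq> i" if "1 \<le> m" "m < Suc (Suc r)" for m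
    \<comment> \<open>Index 1 of s is the site l; a larger index is an inner site of t.\<close>
    using t that by (cases m; cases "m = 1") (auto simp: first_visit_paths_def)
  with t show "s \<in> first_visit_paths i j (Suc (Suc r))"
    by (auto simp: first_visit_paths_def)
qed

text \<open>The first step is the rightmost factor of \<open>path_prod\<close>, so the induction
  peels factors off on the right. \<open>taboo\<close> clears a row and not a column: i may be left
  but not entered, so j = i yields first returns, and the last step enters i through \<Phi>.\<close>

lemma first_visit_operator:
  "(\<Sum>s\<in>first_visit_paths i j (Suc r). conj_map (path_prod B s)) =
    block_mult \<Phi> (block_pow (taboo i) r) $ i $ j"
proof (induction r arbitrary: j)
  case 0
  have "first_visit_paths i j (Suc 0) = {[j, i]}"
    by (auto simp: first_visit_paths_def length_Suc_conv)
  then show ?case by (simp add: block_rep_def)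
next
  case (Suc r)
  let ?F = "\<lambda>l. first_visit_paths i l (Suc r)"
  have prod: "conj_map (path_prod B (j # s)) = conj_map (path_prod B s) o\<^sub>L \<Phi> $ l $ j"
    if "s \<in> ?F l" for l s
  proof -
    from that obtain t where "s = l # t" by (cases s) (auto simp: first_visit_paths_def)
    then show ?thesis by (simp add: block_rep_def conj_map_compose)
  qed
  have disjoint: "(#) j ` ?F l \<inter> (#) j ` ?F m = {}" if "l \<noteq> m" for l m
    using that by (auto simp: first_visit_paths_def)
  have "(\<Sum>s\<in>first_visit_paths i j (Suc (Suc r)). conj_map (path_prod B s)) =
      (\<Sum>l\<in>- {i}. \<Sum>s\<in>(#) j ` ?F l. conj_map (path_prod B s))"
    unfolding first_visit_paths_Suc
    by (rule sum.UNION_disjoint) (auto simp: finite_first_visit_paths intro!: disjoint)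
  also have "\<dots> = (\<Sum>l\<in>- {i}. \<Sum>s\<in>?F l. conj_map (path_prod B (j # s)))"
    by (simp add: sum.reindex)
  also have "\<dots> = (\<Sum>l\<in>- {i}. (\<Sum>s\<in>?F l. conj_map (path_prod B s)) o\<^sub>L \<Phi> $ l $ j)"
    by (simp add: prod blinfun_compose.sum_left)
  also have "\<dots> = (\<Sum>l\<in>- {i}. block_mult \<Phi> (block_pow (taboo i) r) $ i $ l o\<^sub>L \<Phi> $ l $ j)"
    by (simp add: Suc)
  \<comment> \<open>The restriction to sites other than i is absorbed by the zero row of
    \<open>taboo i\<close>.\<close>
  also have "\<dots> = (\<Sum>l\<in>UNIV. block_mult \<Phi> (block_pow (taboo i) r) $ i $ l o\<^sub>L taboo i $ l $ j)"
    by (rule sum.mono_neutral_cong_left) (auto simp: taboo_nth blinfun_compose.zero_right)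
  also have "\<dots> = block_mult \<Phi> (block_pow (taboo i) (Suc r)) $ i $ j"
    by (simp only: block_pow_Suc_right block_mult_assoc[symmetric] block_mult_nth[of "block_mult _ _"])
  finally show ?case .
qed

text \<open>The Neumann series of (I - Q)^(-1) for Q = \<open>taboo i\<close>;
  \<open>weighted_potential\<close> is likewise that of (I - Q)^(-2).\<close>

definition potential :: "'k \<Rightarrow> ('n, 'k) block_op" where
  "potential i = (\<Sum>r. block_pow (taboo i) r)"

definition weighted_potential :: "'k \<Rightarrow> ('n, 'k) block_op" where
  "weighted_potential i = (\<Sum>r. real (Suc r) *\<^sub>R block_pow (taboo i) r)"

lemma bounded_linear_block_nth: "bounded_linear (\<lambda>A :: ('n, 'k) block_op. A $ i $ j)"
  by (intro bounded_linear_compose[OF bounded_linear_vec_nth bounded_linear_vec_nth])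

lemma mean_hitting_nth: "mean_hitting B $ i $ j = block_mult \<Phi> (weighted_potential i) $ i $ j"
proof -
  have "bounded_linear (\<lambda>A. block_mult \<Phi> A $ i $ j)"
    by (rule bounded_linear_compose[OF bounded_linear_block_nth block_mult.bounded_linear_right])
  from bounded_linear.suminf[OF this summable_taboo_pow_weighted]
  have "block_mult \<Phi> (weighted_potential i) $ i $ j =
      (\<Sum>r. real (Suc r) *\<^sub>R (block_mult \<Phi> (block_pow (taboo i) r) $ i $ j))"
    unfolding weighted_potential_def by (simp add: block_mult.scaleR_right)
  then show ?thesis
    by (simp add: mean_hitting_def first_visit_operator)
qed

lemma weighted_potential_equation:
  "weighted_potential i = potential i + block_mult (weighted_potential i) (taboo i)"
proof -
  let ?Q = "block_pow (taboo i)"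
  have "block_mult (weighted_potential i) (taboo i) = (\<Sum>r. real (Suc r) *\<^sub>R ?Q (Suc r))"
    unfolding weighted_potential_def block_pow_Suc_right block_mult.scaleR_left[symmetric]
    by (rule bounded_linear.suminf[OF block_mult.bounded_linear_left summable_taboo_pow_weighted])
  \<comment> \<open>The term at r = 0 vanishes, so the index shift that follows loses
    nothing.\<close>
  moreover have "(\<lambda>r. real r *\<^sub>R ?Q r) sums (weighted_potential i - potential i)"
    using sums_diff[OF summable_sums[OF summable_taboo_pow_weighted] summable_sums[OF summable_taboo_pow_plain], of i i]
    by (simp add: weighted_potential_def potential_def scaleR_left_distrib)
  then have "(\<lambda>r. real (Suc r) *\<^sub>R ?Q (Suc r)) sums (weighted_potential i - potential i)"
    by (subst sums_Suc_iff) simp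
  ultimately show ?thesis by (simp add: sums_iff)
qed

text \<open>The target is reached almost surely: the trace that has not yet arrived starts at the
  trace of X and tends to zero, and its decrements are the first visits.\<close>

lemma trace_first_visit: "trace ((block_mult \<Phi> (potential i) $ i $ j) X) = trace X"
proof -
  define t where "t r = (\<Sum>l\<in>UNIV. trace ((block_pow (taboo i) r $ l $ j) X))" for r
  have bl: "bounded_linear (\<lambda>A :: ('n, 'k) block_op. trace (blinfun_apply (A $ l $ j) X))" for l
    by (intro bounded_linear_compose[OF bounded_linear_trace]
        bounded_linear_compose[OF blinfun.bounded_linear_left bounded_linear_block_nth])
  have t0: "t 0 = trace X"
  proof -
    have "trace ((block_pow (taboo i) 0 $ l $ j) X) = (if l = j then trace X else 0)" for l
      by (simp add: block_id_def)
    then show ?thesis by (simp add: t_def)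
  qed
  have "block_pow (taboo i) \<longlonglongrightarrow> 0"
    by (rule summable_LIMSEQ_zero[OF summable_taboo_pow_plain])
  then have "t \<longlonglongrightarrow> (\<Sum>l\<in>(UNIV::'k set). trace (((0 :: ('n, 'k) block_op) $ l $ j) X))"
    unfolding t_def by (intro tendsto_sum bounded_linear.tendsto[OF bl])
  then have "t \<longlonglongrightarrow> 0" by simp
  then have "(\<lambda>r. t r - t (Suc r)) sums trace X"
    using telescope_sums'[of t 0] by (simp add: t0)
  moreover have "t r - t (Suc r) = trace ((block_mult \<Phi> (block_pow (taboo i) r) $ i $ j) X)" for r
    unfolding t_def trace_taboo_pow_Suc by simp
  moreover have "bounded_linear (\<lambda>A. trace (blinfun_apply (block_mult \<Phi> A $ i $ j) X))"
    by (rule bounded_linear_compose[OF bl block_mult.bounded_linear_right])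
  then have "(\<lambda>r. trace ((block_mult \<Phi> (block_pow (taboo i) r) $ i $ j) X)) sums
      trace ((block_mult \<Phi> (potential i) $ i $ j) X)"
    unfolding potential_def
    by (rule bounded_linear.sums) (rule summable_sums[OF summable_taboo_pow_plain])
  ultimately show ?thesis by (simp add: sums_iff)
qed

text \<open>Each row has its own target and hence its own potential, so the array is assembled row
  by row.\<close>

definition hitting_prob :: "('n, 'k) block_op" where
  "hitting_prob = (\<chi> i j. block_mult \<Phi> (potential i) $ i $ j)"

lemma trace_hitting_prob: "trace ((hitting_prob $ i $ j) X) = trace X"
  by (simp add: hitting_prob_def trace_first_visit)

lemma mean_hitting_equation:
  defines "N \<equiv> mean_hitting B - block_diag (mean_hitting B)"
  shows "N + block_diag (mean_hitting B) = hitting_prob + block_mult N \<Phi>"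
proof -
  have "mean_hitting B $ i $ j = hitting_prob $ i $ j + block_mult N \<Phi> $ i $ j" for i j
  proof -
    have "mean_hitting B $ i $ j = block_mult \<Phi> (potential i) $ i $ j +
        block_mult (block_mult \<Phi> (weighted_potential i)) (taboo i) $ i $ j"
      unfolding mean_hitting_nth
      by (subst weighted_potential_equation) (simp add: block_mult.add_right block_mult_assoc)
    \<comment> \<open>For l = i both summands vanish, by the zero row of \<open>taboo i\<close> and
      the zero diagonal of N; for other l they agree factor by factor.\<close>
    also have "block_mult (block_mult \<Phi> (weighted_potential i)) (taboo i) $ i $ j = block_mult N \<Phi> $ i $ j"
      unfolding block_mult_nth[of "block_mult _ _"] block_mult_nth[of N] mean_hitting_nth[symmetric]
      by (rule sum.cong)
        (auto simp: N_def taboo_nth block_diag_def blinfun_compose.zero_left blinfun_compose.zero_right)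
    finally show ?thesis by (simp add: hitting_prob_def)
  qed
  then show ?thesis by (simp add: N_def vec_eq_iff)
qed

text \<open>The trace of N - N \<Omega> = F Z - D Z at (i, j), with F = \<open>hitting_prob\<close>.
  The sum over l comes from N \<Omega> and does not depend on j.\<close>

lemma trace_hitting_time:
  defines "N \<equiv> mean_hitting B - block_diag (mean_hitting B)"
    and "D \<equiv> block_diag (mean_hitting B)"
    and "Z \<equiv> fundamental B"
  shows "trace ((N $ i $ j) X) =
    trace (\<Sum>l\<in>UNIV. (N $ i $ l) (avg_map (CARD('k) * CARD('n)) X)) + trace X -
    trace ((block_mult D Z $ i $ j) X)"
proof -
  have eq: "N - block_mult N \<Phi> = hitting_prob - D"
    using mean_hitting_equation by (simp add: N_def D_def algebra_simps)
  have "N - block_mult N \<Omega> = block_mult N (block_id - \<Omega>)"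
    by (simp add: block_mult.diff_right)
  also have "\<dots> = block_mult (N - block_mult N \<Phi>) Z"
    unfolding Z_def fundamental_equation[symmetric]
    by (simp add: block_mult.diff_right block_mult.diff_left block_mult_assoc)
  also have "\<dots> = block_mult hitting_prob Z - block_mult D Z"
    by (simp add: eq block_mult.diff_left)
  finally have "N $ i $ j = block_mult N \<Omega> $ i $ j + block_mult hitting_prob Z $ i $ j - block_mult D Z $ i $ j"
    by (metis (no_types, lifting) add_diff_eq diff_add_cancel add.commute vector_add_component vector_minus_component)
  moreover have "trace ((block_mult hitting_prob Z $ i $ j) X) = trace X"
    by (simp add: block_mult_nth[of hitting_prob] blinfun.sum_left trace_sum trace_hitting_prob
        trace_fundamental_column Z_def)
  ultimately show ?thesis
    by (simp add: blinfun.add_left blinfun.diff_left trace_add trace_sub block_mult_nth[of N]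
        blinfun.sum_left omega_def)
qed

end

theorem theorem2p4:
  fixes B :: "'k::finite \<Rightarrow> 'k \<Rightarrow> complex^'n^'n"
    and \<rho> :: "complex^'n^'n" and i j :: 'k
    and D N Z :: "('n, 'k) block_op"
  assumes "CARD('n) \<ge> 2" and "CARD('k) \<ge> 2"
    and "oqw B" and "ergodic B"
    and "Z = fundamental B"
    and "D = block_diag (mean_hitting B)"
    and "N = mean_hitting B - D"
    and "density_matrix \<rho>"
  shows "trace (blinfun_apply (N $ i $ j) \<rho>) =
    trace (blinfun_apply (block_mult D Z $ i $ i - block_mult D Z $ i $ j) \<rho>)"
proof -
  interpret ergodic_oqw B
    using assms(3,4) by unfold_locales
  \<comment> \<open>The identity at (i, i) therefore evaluates the part that does not depend on
    j.\<close>
  have "N $ i $ i = 0"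
    by (simp add: assms(6,7) block_diag_def)
  then have "trace (\<Sum>l\<in>UNIV. (N $ i $ l) (avg_map (CARD('k) * CARD('n)) \<rho>)) + trace \<rho> =
      trace ((block_mult D Z $ i $ i) \<rho>)"
    using trace_hitting_time[of i i \<rho>] by (simp add: assms(5-7))
  then show ?thesis
    using trace_hitting_time[of i j \<rho>] by (simp add: assms(5-7) blinfun.diff_left trace_sub)
qed

end
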